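(* For $\lambda \in \mathbb{R}$, $$\int_0^1 \ln(-\ln x)\,\frac{1}{x+e^{i\lambda}}\,dx = \sum_{k=1}^{\infty} \frac{(-1)^k}{k}\,e^{-ik\lambda}\,(\gamma+\ln k).$$
   Context: Here $i=\sqrt{-1}$, $\ln$ is the natural logarithm, and $\gamma = \lim_{n\to\infty}\left(\sum_{k=1}^n \frac1k - \ln n\right)$ is the Euler-Mascheroni constant.
   Formalization: When λ is an odd multiple of π (e^{iλ} = −1), the integral and the series both diverge, so the identity is proved for all other real λ, with convergence of both sides; for those exceptional λ it is proved instead that both sides tend to +∞. *)

theory Defs
  imports "HOL-Analysis.Analysis"
begin

(* Real ln is total, so the values at x = 0 and x = 1 are artefacts; the two
   endpoints form a null set and do not affect the integral over {0..1}. *)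
definition loglog_integrand :: "real \<Rightarrow> real \<Rightarrow> complex" where
  "loglog_integrand \<theta> x =
     of_real (ln (- ln x)) * (1 / (of_real x + exp (\<i> * of_real \<theta>)))"

(* Only the indices k >= 1 are meaningful. *)
definition loglog_term :: "real \<Rightarrow> nat \<Rightarrow> complex" where
  "loglog_term \<theta> k =
     (-1) ^ k / of_nat k * exp (- (\<i> * of_nat k * of_real \<theta>))
       * of_real (euler_mascheroni + ln (real k))"

(* If exp (i theta) = -1, that is, theta is an odd multiple of pi, then the integrand is
   ln (- ln x) / (x - 1) and the terms are (gamma + ln k) / k.  All of these are real, and
   the integral (because of its singularity at x = 1) and the series diverge to +infinity,
   so that the identity between them has to be read in the extended reals.  For every other
   theta both sides are finite; the series then converges only conditionally. *)

end

theory Submission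
  imports Defs
begin

text \<open>With \<open>z = - exp (- \<i> \<theta>)\<close> the kernel is \<open>1 / (x + exp (\<i> \<theta>)) = - (\<Sum>k. z\<^sup>k\<^sup>+\<^sup>1 x\<^sup>k)\<close>, and
  \<open>x = exp (- t / (m + 1))\<close> turns the moment of \<open>ln (- ln x)\<close> against \<open>x\<^sup>m\<close> into
  \<open>\<Gamma>'(1) = - \<gamma>\<close> plus an elementary integral. The partial sums of the series are therefore the
  integrals of \<open>ln (- ln x)\<close> against the kernel times \<open>1 - (z x)\<^sup>n\<close>. For \<open>z \<noteq> 1\<close> the kernel is
  bounded on the unit interval, so dominated convergence gives convergence of the series and its
  value at once, without Abel summation. For \<open>z = 1\<close> both sides dominate a divergent
  elementary integral or the harmonic series.\<close>

section \<open>Differentiating the Gamma integral at 1\<close>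

text \<open>Convexity of \<open>exp\<close>: \<open>h * ln t\<close> lies between 0 and
  \<open>k * ln t\<close> with weight \<open>h/k\<close>, so chord slopes from 0 increase. This is
  the monotonicity needed for monotone convergence below.\<close>

lemma powr_diff_quotient_mono:
  fixes t h k :: real
  assumes "t > 0" "0 < h" "h \<le> k"
  shows "(t powr h - 1) / h \<le> (t powr k - 1) / k"
proof -
  have "exp ((1 - h/k) *\<^sub>R 0 + (h/k) *\<^sub>R (k * ln t)) \<le> (1 - h/k) * exp 0 + (h/k) * exp (k * ln t)"
    using assms by (intro convex_onD[OF exp_convex]) auto
  then have "t powr h \<le> 1 - h/k + (h/k) * t powr k"
    using assms by (simp add: powr_def)
  then have "(t powr h - 1) / h \<le> ((h/k) * (t powr k - 1)) / h"
    using assms by (intro divide_right_mono) (auto simp: right_diff_distrib)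
  then show ?thesis
    using assms by simp
qed

lemma tendsto_difference_quotient_inverse_Suc:
  fixes f :: "real \<Rightarrow> real"
  assumes "(f has_field_derivative D) (at a)"
  shows "(\<lambda>n. (f (a + inverse (real (Suc n))) - f a) / inverse (real (Suc n))) \<longlonglongrightarrow> D"
proof -
  have "filterlim (\<lambda>n. inverse (real (Suc n))) (at 0) sequentially"
    by (intro filterlim_atI LIMSEQ_inverse_real_of_nat) auto
  moreover have "((\<lambda>h. (f (a + h) - f a) / h) \<longlongrightarrow> D) (at 0)"
    using assms by (simp add: DERIV_def)
  ultimately show ?thesis
    by (rule filterlim_compose[rotated])
qed

text \<open>Serves to drop the endpoint 0 from the Gamma integral: the difference quotients of
  \<open>t powr s\<close> at \<open>s = 0\<close> converge only for \<open>t > 0\<close>.\<close>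

lemma has_integral_atLeast_iff_greaterThan:
  fixes f :: "real \<Rightarrow> 'a :: banach"
  shows "(f has_integral I) {a..} \<longleftrightarrow> (f has_integral I) {a<..}"
proof (rule has_integral_spike_set_eq)
  show "negligible {x \<in> {a..} - {a<..}. f x \<noteq> 0}"
    by (rule negligible_subset[of "{a}"]) auto
  show "negligible {x \<in> {a<..} - {a..}. f x \<noteq> 0}"
    by (rule negligible_subset[of "{}"]) auto
qed

text \<open>The difference quotients of \<open>s \<mapsto> t powr s\<close> decrease to \<open>ln t\<close>, so monotone convergence
  differentiates the Gamma integral under the integral sign at \<open>s = 1\<close>.\<close>

lemma has_integral_ln_exp:
  "((\<lambda>t::real. ln t * exp (- t)) has_integral - euler_mascheroni) {0<..}"
proof -
  define h where "h n = inverse (real (Suc n))" for n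
  define f where "f n t = (t powr h n - 1) / h n * exp (- t)" for n and t :: real
  have h_pos: "h n > 0" for n
    by (simp add: h_def)
  have Gamma: "((\<lambda>t. t powr (x - 1) / exp t) has_integral Gamma x) {0<..}" if "x > 0" for x :: real
    using Gamma_integral_real[OF that] by (simp add: has_integral_atLeast_iff_greaterThan)
  have f_int: "(f n has_integral (Gamma (1 + h n) - Gamma 1) / h n) {0<..}" for n
  proof -
    have "((\<lambda>t. (t powr (1 + h n - 1) / exp t - t powr (1 - 1) / exp t) / h n) has_integral
            (Gamma (1 + h n) - Gamma 1) / h n) {0<..}"
      using h_pos[of n] by (intro has_integral_divide has_integral_diff Gamma) auto
    then show ?thesis
      by (rule has_integral_eq[rotated]) (simp add: f_def exp_minus field_simps)
  qed
  \<comment> \<open>The limit is the derivative of \<open>Gamma\<close> at 1, and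
    \<open>Digamma 1\<close> is minus the Euler-Mascheroni constant.\<close>
  have "(\<lambda>n. (Gamma (1 + h n) - Gamma 1) / h n) \<longlonglongrightarrow> Gamma 1 * Digamma (1::real)"
    unfolding h_def by (intro tendsto_difference_quotient_inverse_Suc has_field_derivative_Gamma) auto
  then have lim: "(\<lambda>n. integral {0<..} (f n)) \<longlonglongrightarrow> - euler_mascheroni"
    unfolding integral_unique[OF f_int] by simp
  have conv: "(\<lambda>n. f n t) \<longlonglongrightarrow> ln t * exp (- t)" if "t \<in> {0<..}" for t
  proof -
    have "((\<lambda>s. t powr s) has_field_derivative ln t) (at 0)"
      using that by (auto intro!: derivative_eq_intros)
    from tendsto_difference_quotient_inverse_Suc[OF this] that show ?thesis
      unfolding f_def h_def by (intro tendsto_mult_right) simp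
  qed
  have "(\<lambda>t::real. ln t * exp (- t)) integrable_on {0<..} \<and>
        (\<lambda>n. integral {0<..} (f n)) \<longlonglongrightarrow> integral {0<..} (\<lambda>t. ln t * exp (- t))"
  proof (rule monotone_convergence_decreasing)
    show "f n integrable_on {0<..}" for n
      using f_int by blast
    show "f (Suc n) t \<le> f n t" if "t \<in> {0<..}" for n t
    proof -
      have "h (Suc n) \<le> h n" by (simp add: h_def)
      then show ?thesis
        unfolding f_def using that h_pos
        by (intro mult_right_mono powr_diff_quotient_mono) auto
    qed
    show "bounded (range (\<lambda>n. integral {0<..} (f n)))"
      using lim convergent_imp_bounded by blast
  qed (rule conv)
  with lim show ?thesis
    by (metis LIMSEQ_unique has_integral_integral)
qed

text \<open>The integrand changes sign, but it is integrable and, by \<open>ln t < t\<close>, lies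
  below the nonnegative integrand of \<open>Gamma 2\<close>. An absolutely integrable upper bound
  suffices for absolute integrability.\<close>

lemma absolutely_integrable_ln_exp:
  "(\<lambda>t::real. ln t * exp (- t)) absolutely_integrable_on {0<..}"
proof (rule absolutely_integrable_absolutely_integrable_ubound)
  show "(\<lambda>t::real. ln t * exp (- t)) integrable_on {0<..}"
    using has_integral_ln_exp by blast
  have "(\<lambda>t::real. t powr (2 - 1) / exp t) integrable_on {0..}"
    using Gamma_integral_real[of 2] by (auto simp: integrable_on_def)
  then have "(\<lambda>t::real. t powr (2 - 1) / exp t) absolutely_integrable_on {0..}"
    by (rule nonnegative_absolutely_integrable_1) auto
  then show "(\<lambda>t::real. t powr (2 - 1) / exp t) absolutely_integrable_on {0<..}"
    by (rule set_integrable_subset) auto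
  show "ln t * exp (- t) \<le> t powr (2 - 1) / exp t" if "t \<in> {0<..}" for t :: real
    using that less_imp_le[OF ln_less_self, of t] by (simp add: exp_minus field_simps)
qed

lemma has_integral_exp_neg:
  "((\<lambda>t::real. exp (- t)) has_integral 1) {0<..}"
  using has_integral_exp_minus_to_infinity[of 1 0]
  by (simp add: has_integral_atLeast_iff_greaterThan)

section \<open>Moments of the iterated logarithm on the unit interval\<close>

lemma loglog_power_moment:
  fixes m :: nat
  shows "(\<lambda>x::real. ln (- ln x) * x ^ m) absolutely_integrable_on {0..1}"
    and "((\<lambda>x::real. ln (- ln x) * x ^ m) has_integral
           - (euler_mascheroni + ln (real (Suc m))) / real (Suc m)) {0..1}"
proof -
  define k where "k = real (Suc m)"
  define b where "b = - (euler_mascheroni + ln k) / k"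
  let ?F = "\<lambda>x::real. ln (- ln x) * x ^ m"
  let ?g = "\<lambda>t::real. exp (- t / k)"
  \<comment> \<open>The transformed integrand. The absolute value accounts for \<open>?g\<close>
    being decreasing.\<close>
  let ?G = "\<lambda>t::real. \<bar>- exp (- t / k) / k\<bar> * ?F (?g t)"
  have k: "k > 0" by (simp add: k_def)
  have G_eq: "?G t = (ln t * exp (- t) - ln k * exp (- t)) / k" if "t \<in> {0<..}" for t
  proof -
    \<comment> \<open>The Jacobian contributes one more factor \<open>x\<close> to
      \<open>x ^ m\<close>, and \<open>x ^ Suc m = exp (- t)\<close> because
      \<open>k = Suc m\<close>.\<close>
    have "exp (- t / k) * exp (- t / k) ^ m = exp (- t / k) ^ Suc m"
      by simp
    also have "\<dots> = exp (k * (- t / k))"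
      unfolding k_def by (rule exp_of_nat_mult[symmetric])
    finally have exp_eq: "exp (- t / k) * exp (- t / k) ^ m = exp (- t)"
      using k by simp
    have ln_eq: "ln (- ln (?g t)) = ln t - ln k"
      using that k by (simp add: ln_div)
    have "?G t = (exp (- t / k) * exp (- t / k) ^ m) * ln (- ln (?g t)) / k"
      using k by simp
    also have "\<dots> = exp (- t) * (ln t - ln k) / k"
      by (simp only: exp_eq ln_eq)
    finally show ?thesis
      by (simp only: right_diff_distrib mult.commute)
  qed
  have G_abs: "?G absolutely_integrable_on {0<..}"
  proof -
    have "(\<lambda>t::real. exp (- t)) absolutely_integrable_on {0<..}"
      using has_integral_exp_neg by (intro nonnegative_absolutely_integrable_1) auto
    then have "(\<lambda>t. (ln t * exp (- t) - ln k * exp (- t)) / k) absolutely_integrable_on {0<..}"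
      using absolutely_integrable_ln_exp
      by (intro set_integrable_divide set_integral_diff set_integrable_mult_right) auto
    then show ?thesis
      using G_eq by (subst set_integrable_cong[OF refl refl]) auto
  qed
  have "((\<lambda>t. (ln t * exp (- t) - ln k * exp (- t)) / k) has_integral
          (- euler_mascheroni - ln k * 1) / k) {0<..}"
    by (intro has_integral_divide has_integral_diff has_integral_mult_right
          has_integral_ln_exp has_integral_exp_neg)
  then have "(?G has_integral b) {0<..}"
    by (subst has_integral_cong[OF G_eq]) (simp_all add: b_def)
  then have G_int: "integral {0<..} ?G = b"
    by (rule integral_unique)
  have image: "?g ` {0<..} = {0<..<1}"
  proof (intro equalityI subsetI)
    fix x :: real assume "x \<in> {0<..<1}"
    then show "x \<in> ?g ` {0<..}"
      using k by (intro image_eqI[of _ _ "- (k * ln x)"]) (auto simp: mult_pos_neg)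
  qed (use k in auto)
  have "?F absolutely_integrable_on ?g ` {0<..} \<and> integral (?g ` {0<..}) ?F = b"
  proof (rule has_absolute_integral_change_of_variables_1'[THEN iffD1])
    show "(?g has_field_derivative - exp (- t / k) / k) (at t within {0<..})" for t
      using k by (auto intro!: derivative_eq_intros)
    show "inj_on ?g {0<..}"
      using k by (auto simp: inj_on_def)
    show "?G absolutely_integrable_on {0<..} \<and> integral {0<..} ?G = b"
      using G_abs G_int by blast
  qed auto
  then have F: "?F absolutely_integrable_on {0<..<1}" "integral {0<..<1} ?F = b"
    unfolding image by auto
  then show "?F absolutely_integrable_on {0..1}"
    by (simp add: absolutely_integrable_on_def integrable_on_Icc_iff_Ioo)
  from F have "(?F has_integral b) {0<..<1}"
    by (metis absolutely_integrable_on_def has_integral_integral)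
  then show "(?F has_integral - (euler_mascheroni + ln (real (Suc m))) / real (Suc m)) {0..1}"
    by (simp add: has_integral_Icc_iff_Ioo b_def k_def)
qed

section \<open>The convergent case\<close>

text \<open>A zero of the denominator in the unit interval has modulus 1, hence is
  \<open>x = 1\<close>, which the assumption excludes. The kernel is then continuous on a compact
  interval.\<close>

lemma inverse_add_exp_bounded:
  fixes \<theta> :: real
  assumes "exp (\<i> * of_real \<theta>) \<noteq> (-1 :: complex)"
  obtains C where "\<And>x. x \<in> {0..1} \<Longrightarrow> of_real x + exp (\<i> * of_real \<theta>) \<noteq> (0 :: complex)"
    and "\<And>x. x \<in> {0..1} \<Longrightarrow> norm (1 / (of_real x + exp (\<i> * of_real \<theta>)) :: complex) \<le> C"
proof -
  define e where "e = (exp (\<i> * of_real \<theta>) :: complex)"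
  have norm_e: "norm e = 1"
    by (simp add: e_def)
  have nz: "of_real x + e \<noteq> 0" if "x \<in> {0..1}" for x :: real
  proof
    assume "of_real x + e = 0"
    then have e: "e = - of_real x"
      by (simp add: add_eq_0_iff)
    then have "x = 1"
      using norm_e that by simp
    with e assms show False
      by (simp add: e_def)
  qed
  have "compact ((\<lambda>x. 1 / (of_real x + e)) ` {0..1::real})"
    using nz by (intro compact_continuous_image continuous_intros) auto
  then obtain C where "\<forall>y \<in> (\<lambda>x. 1 / (of_real x + e)) ` {0..1::real}. norm y \<le> C"
    using compact_imp_bounded bounded_iff by blast
  with nz that show ?thesis
    unfolding e_def by blast
qed

lemma loglog_integral_eq_series:
  fixes \<theta> :: real
  assumes "exp (\<i> * of_real \<theta>) \<noteq> (-1 :: complex)"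
  shows "loglog_integrand \<theta> absolutely_integrable_on {0..1}"
    and "(\<lambda>k. loglog_term \<theta> (Suc k)) sums integral {0..1} (loglog_integrand \<theta>)"
proof -
  define e where "e = (exp (\<i> * of_real \<theta>) :: complex)"
  define z where "z = (- exp (- (\<i> * of_real \<theta>)) :: complex)"
  define L where "L x = ln (- ln x)" for x :: real
  define P where "P n x = of_real (L x) * (1 / (of_real x + e) * (1 - (z * of_real x) ^ n))"
    for n and x :: real
  obtain C where nz: "\<And>x. x \<in> {0..1} \<Longrightarrow> of_real x + e \<noteq> 0"
    and C: "\<And>x. x \<in> {0..1} \<Longrightarrow> norm (1 / (of_real x + e)) \<le> C"
    using inverse_add_exp_bounded[OF assms] unfolding e_def by metis
  have ze: "z * e = -1"
    by (simp add: z_def e_def exp_minus)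
  have norm_z: "norm z = 1"
    by (simp add: z_def)
  have norm_zx: "norm (z * of_real x) = \<bar>x\<bar>" for x :: real
    by (simp add: norm_mult norm_z)
  have L_abs: "L absolutely_integrable_on {0..1}"
    using loglog_power_moment(1)[of 0] unfolding L_def by simp
  have P_sum: "P n x = (\<Sum>k<n. - (z ^ Suc k) * of_real (L x * x ^ k))" if "x \<in> {0..1}" for n x
  proof -
    \<comment> \<open>From \<open>z * e = -1\<close>, the denominator is a multiple of
      \<open>1 - z * of_real x\<close>, so it divides the finite geometric sum exactly.\<close>
    have "(of_real x + e) * (- z) = 1 - z * of_real x"
      using ze by (simp add: algebra_simps)
    then have "1 - (z * of_real x) ^ n = (of_real x + e) * (- z) * (\<Sum>k<n. (z * of_real x) ^ k)"
      by (simp add: one_diff_power_eq)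
    then have "1 / (of_real x + e) * (1 - (z * of_real x) ^ n) = - z * (\<Sum>k<n. (z * of_real x) ^ k)"
      using nz[OF that] by simp
    then show ?thesis
      by (simp add: P_def sum_distrib_left power_mult_distrib mult_ac sum_negf)
  qed
  \<comment> \<open>The minus sign of the kernel expansion cancels that of the moment;
    \<open>z ^ Suc k\<close> carries both the alternating sign and the phase.\<close>
  have term_eq: "loglog_term \<theta> (Suc k) =
      - (z ^ Suc k) * of_real (- (euler_mascheroni + ln (real (Suc k))) / real (Suc k))" for k
  proof -
    have "z ^ Suc k = (-1) ^ Suc k * exp (- (\<i> * of_nat (Suc k) * of_real \<theta>))"
      unfolding z_def
      by (subst power_minus) (simp only: exp_of_nat_mult[symmetric] mult_ac mult_minus_right)
    then show ?thesis
      unfolding loglog_term_def by (simp add: field_simps del: of_nat_Suc power_Suc)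
  qed
  have P_int: "(P n has_integral (\<Sum>k<n. loglog_term \<theta> (Suc k))) {0..1}" for n
  proof -
    have "((\<lambda>x. \<Sum>k<n. - (z ^ Suc k) * of_real (L x * x ^ k)) has_integral
            (\<Sum>k<n. loglog_term \<theta> (Suc k))) {0..1}"
      unfolding term_eq L_def
      by (intro has_integral_sum has_integral_mult_right has_integral_of_real loglog_power_moment) auto
    then show ?thesis
      using P_sum by (subst has_integral_cong) auto
  qed
  have P_bound: "norm (P n x) \<le> 2 * C * \<bar>L x\<bar>" if "x \<in> {0..1}" for n x
  proof -
    have "norm ((z * of_real x) ^ n) \<le> 1"
      using that norm_zx[of x] by (simp add: norm_power power_le_one)
    then have "norm (1 - (z * of_real x) ^ n) \<le> 2"
      using norm_triangle_ineq4[of 1 "(z * of_real x) ^ n"] by simp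
    then have "norm (P n x) \<le> \<bar>L x\<bar> * (C * 2)"
      unfolding P_def norm_mult using C[OF that] order_trans[OF norm_ge_zero C[OF that]]
      by (auto intro!: mult_mono)
    then show ?thesis by (simp add: mult_ac)
  qed
  have bound_int: "(\<lambda>x. 2 * C * \<bar>L x\<bar>) integrable_on {0..1}"
    using L_abs by (intro integrable_on_mult_right) (auto simp: absolutely_integrable_on_def)
  have P_lim: "(\<lambda>n. P n x) \<longlonglongrightarrow> loglog_integrand \<theta> x" if "x \<in> {0..1}" for x
  proof (cases "x = 1")
    \<comment> \<open>Here the powers of \<open>z * of_real x\<close> stay on the unit circle, but
      \<open>L 1 = ln 0 = 0\<close> by totality of \<open>ln\<close>, so both sides vanish.\<close>
    case True
    then show ?thesis by (simp add: P_def loglog_integrand_def L_def)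
  next
    case False
    then have "(\<lambda>n. (z * of_real x) ^ n) \<longlonglongrightarrow> 0"
      using that by (intro LIMSEQ_power_zero) (simp add: norm_zx)
    then have "(\<lambda>n. P n x) \<longlonglongrightarrow> of_real (L x) * (1 / (of_real x + e) * (1 - 0))"
      unfolding P_def by (intro tendsto_mult tendsto_diff tendsto_const)
    then show ?thesis by (simp add: loglog_integrand_def L_def e_def)
  qed
  note dc = dominated_convergence[of P "{0..1}", OF _ bound_int P_bound P_lim]
  have int: "loglog_integrand \<theta> integrable_on {0..1}"
    using dc(1) P_int by blast
  \<comment> \<open>The bound is uniform in \<open>n\<close> and so passes to the pointwise limit,
    which upgrades integrability to absolute integrability.\<close>
  have "norm (loglog_integrand \<theta> x) \<le> 2 * C * \<bar>L x\<bar>" if "x \<in> {0..1}" for x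
    using P_lim[OF that] P_bound[OF that] by (intro LIMSEQ_le_const2[OF tendsto_norm]) auto
  then show "loglog_integrand \<theta> absolutely_integrable_on {0..1}"
    using int bound_int by (rule absolutely_integrable_integrable_bound)
  have "(\<lambda>n. integral {0..1} (P n)) \<longlonglongrightarrow> integral {0..1} (loglog_integrand \<theta>)"
    using dc(2) P_int by blast
  then show "(\<lambda>k. loglog_term \<theta> (Suc k)) sums integral {0..1} (loglog_integrand \<theta>)"
    unfolding sums_def integral_unique[OF P_int] .
qed

section \<open>The divergent case\<close>

text \<open>Near 1 the factor \<open>ln (- ln x)\<close> is at most -1, so the integrand is at least
  \<open>1 / (1 - x)\<close>, whose integral up to \<open>t\<close> grows like
  \<open>- ln (1 - t)\<close>.\<close>

lemma loglog_integral_diverges: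
  fixes \<theta> :: real
  assumes "exp (\<i> * of_real \<theta>) = (-1 :: complex)"
  shows "filterlim (\<lambda>t. Re (integral {0..t} (loglog_integrand \<theta>))) at_top (at_left 1)"
proof -
  define f where "f x = ln (- ln x) * (1 / (x - 1))" for x :: real
  \<comment> \<open>Chosen so that \<open>ln (- ln a) = -1\<close>.\<close>
  define a where "a = exp (- exp (-1) :: real)"
  have a: "0 < a" "a < 1"
    by (auto simp: a_def)
  have eq: "loglog_integrand \<theta> = (\<lambda>x. of_real (f x))"
    using assms by (auto simp: loglog_integrand_def f_def fun_eq_iff)
  \<comment> \<open>Away from 1 the factor \<open>1 / (x - 1)\<close> is bounded and continuous,
    while the singularity of \<open>ln (- ln x)\<close> at 0 is absolutely integrable.\<close>
  have f_int: "f integrable_on {0..t}" if "t < 1" for t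
  proof -
    have "(\<lambda>x. ln (- ln x)) absolutely_integrable_on {0..1::real}"
      using loglog_power_moment(1)[of 0] by simp
    then have "(\<lambda>x. ln (- ln x)) absolutely_integrable_on {0..t}"
      by (rule set_integrable_subset) (use that in auto)
    moreover have "continuous_on {0..t} (\<lambda>x. 1 / (x - 1))"
      using that by (intro continuous_intros) auto
    moreover have "bounded ((\<lambda>x. 1 / (x - 1)) ` {0..t})"
      using that by (intro compact_imp_bounded compact_continuous_image continuous_intros) auto
    ultimately have "(\<lambda>x. 1 / (x - 1) * ln (- ln x)) absolutely_integrable_on {0..t}"
      by (intro absolutely_integrable_bounded_measurable_product_real
            continuous_imp_measurable_on_sets_lebesgue) auto
    then show ?thesis
      unfolding f_def by (simp add: absolutely_integrable_on_def mult.commute)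
  qed
  have lower: "integral {0..a} f + (ln (1 - a) - ln (1 - t)) \<le> integral {0..t} f"
    if "t \<in> {a<..<1}" for t
  proof -
    have ftc: "((\<lambda>x. 1 / (1 - x)) has_integral (- ln (1 - t) - - ln (1 - a))) {a..t}"
      using that by (intro fundamental_theorem_of_calculus)
        (auto intro!: derivative_eq_intros simp: has_real_derivative_iff_has_vector_derivative[symmetric])
    have "- ln (1 - t) - - ln (1 - a) \<le> integral {a..t} f"
    proof (rule has_integral_le[OF ftc])
      show "(f has_integral integral {a..t} f) {a..t}"
        using integrable_on_subinterval[OF f_int[of t], of a t] that a by auto
      show "1 / (1 - x) \<le> f x" if x: "x \<in> {a..t}" for x
      proof -
        have x1: "0 < x" "x < 1" "a \<le> x" using x \<open>t \<in> {a<..<1}\<close> a by auto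
        then have "ln a \<le> ln x" using a by simp
        then have "- ln x \<le> exp (-1)" by (simp add: a_def)
        moreover have "0 < - ln x" using x1 by simp
        ultimately have "ln (- ln x) \<le> -1"
          by (metis ln_exp ln_mono)
        then show ?thesis
          using x1 divide_right_mono[of 1 "- ln (- ln x)" "1 - x"]
          by (simp add: f_def minus_divide_right)
      qed
    qed
    moreover have "integral {0..a} f + integral {a..t} f = integral {0..t} f"
      using that a f_int[of t] by (intro Henstock_Kurzweil_Integration.integral_combine) auto
    ultimately show ?thesis by simp
  qed
  have "filterlim (\<lambda>t::real. 1 - t) (at_right 0) (at_left 1)"
  proof (rule filterlim_at_withinI)
    show "((\<lambda>t::real. 1 - t) \<longlongrightarrow> 0) (at_left 1)"
      by (rule tendsto_eq_intros refl | simp)+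
    show "\<forall>\<^sub>F t in at_left (1::real). 1 - t \<in> {0<..} - {0}"
      using eventually_at_left_real[of 0 "1::real"] by (auto elim: eventually_mono)
  qed
  then have "filterlim (\<lambda>t::real. ln (1 - t)) at_bot (at_left 1)"
    by (rule filterlim_compose[OF ln_at_0])
  then have "filterlim (\<lambda>t::real. - ln (1 - t)) at_top (at_left 1)"
    by (rule filterlim_compose[OF filterlim_uminus_at_top_at_bot])
  then have "filterlim (\<lambda>t. (integral {0..a} f + ln (1 - a)) + - ln (1 - t)) at_top (at_left 1)"
    by (rule filterlim_tendsto_add_at_top[OF tendsto_const])
  then have "filterlim (\<lambda>t. integral {0..t} f) at_top (at_left 1)"
  proof (rule filterlim_at_top_mono)
    show "\<forall>\<^sub>F t in at_left 1. integral {0..a} f + ln (1 - a) + - ln (1 - t) \<le> integral {0..t} f"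
      using eventually_at_left_real[OF a(2)]
      by eventually_elim (use lower in force)
  qed
  moreover have "\<forall>\<^sub>F t in at_left 1. Re (integral {0..t} (loglog_integrand \<theta>)) = integral {0..t} f"
    using eventually_at_left_real[OF a(2)]
  proof eventually_elim
    case (elim t)
    then have "(f has_integral integral {0..t} f) {0..t}"
      using f_int by auto
    then have "(loglog_integrand \<theta> has_integral of_real (integral {0..t} f)) {0..t}"
      unfolding eq by (rule has_integral_of_real)
    then show ?case
      by (simp add: integral_unique)
  qed
  ultimately show ?thesis
    using filterlim_cong[OF refl refl] by fastforce
qed

text \<open>The phase is \<open>(-1) ^ k\<close> and cancels the alternating sign. Since
  \<open>ln k\<close> is nonnegative, the partial sums dominate a positive multiple of the harmonic
  numbers.\<close>

lemma loglog_series_diverges: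
  fixes \<theta> :: real
  assumes "exp (\<i> * of_real \<theta>) = (-1 :: complex)"
  shows "filterlim (\<lambda>n. Re (\<Sum>k=1..n. loglog_term \<theta> k)) at_top sequentially"
proof -
  have term_eq: "loglog_term \<theta> k = of_real ((euler_mascheroni + ln (real k)) / real k)" for k
  proof -
    have "exp (- (\<i> * of_nat k * of_real \<theta>)) = inverse (exp (\<i> * of_real \<theta>)) ^ k"
      by (simp add: exp_minus exp_of_nat_mult[symmetric] mult_ac power_inverse)
    also have "\<dots> = (-1) ^ k"
      by (simp add: assms)
    finally show ?thesis
      by (simp add: loglog_term_def power_mult_distrib[symmetric])
  qed
  have "filterlim (\<lambda>n. euler_mascheroni * harm n :: real) at_top sequentially"
    by (intro filterlim_tendsto_pos_mult_at_top[OF tendsto_const] euler_mascheroni_pos harm_at_top)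
  then show ?thesis
  proof (rule filterlim_at_top_mono, intro always_eventually allI)
    fix n
    have "euler_mascheroni * harm n = (\<Sum>k=1..n. euler_mascheroni / real k)"
      by (simp add: harm_def sum_distrib_left divide_inverse)
    also have "\<dots> \<le> (\<Sum>k=1..n. (euler_mascheroni + ln (real k)) / real k)"
      by (intro sum_mono divide_right_mono) auto
    also have "\<dots> = Re (\<Sum>k=1..n. loglog_term \<theta> k)"
      by (simp only: term_eq Re_sum Re_complex_of_real)
    finally show "euler_mascheroni * harm n \<le> Re (\<Sum>k=1..n. loglog_term \<theta> k)" .
  qed
qed

text \<open>At odd multiples of \<pi> equality means that both sides are +infinity, expressed by
  truncated integrals and partial sums because \<open>integral\<close> and \<open>suminf\<close> do
  not record divergence. All values are real there, so \<open>Re\<close> loses nothing.\<close>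

theorem proposition2:
  fixes \<theta> :: real
  shows "(exp (\<i> * of_real \<theta>) \<noteq> (-1 :: complex) \<longrightarrow>
           loglog_integrand \<theta> absolutely_integrable_on {0..1} \<and>
           summable (\<lambda>k. loglog_term \<theta> (Suc k)) \<and>
           integral {0..1} (loglog_integrand \<theta>) = (\<Sum>k. loglog_term \<theta> (Suc k))) \<and>
         (exp (\<i> * of_real \<theta>) = (-1 :: complex) \<longrightarrow>
           filterlim (\<lambda>t. Re (integral {0..t} (loglog_integrand \<theta>))) at_top (at_left 1) \<and>
           filterlim (\<lambda>n. Re (\<Sum>k=1..n. loglog_term \<theta> k)) at_top sequentially)"
  using loglog_integral_eq_series loglog_integral_diverges loglog_series_diverges
  by (simp add: sums_iff)

end
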